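(* For all $L>0$, all integers $T\ge 1$, and all integers $d\ge 8(T+1)^2+T$, the minimax $T$-risk of the class $\mathsf{Ent}_d(L)$ satisfies $$\mathsf{Risk}_d(T,L)>\frac{L}{4(T+1)} .$$
   Context: $\Delta_d=\{x\in\mathbb{R}^d: x\ge 0,\ \sum_k (x)_k=1\}$ is the standard simplex, $\operatorname{ri}(\Delta_d)$ its relative interior (all entries positive), $\mathsf{1}_d$ the all-ones vector, $\Theta_d:=\operatorname{span}\{\mathsf{1}_d\}^\perp\subset\mathbb{R}^d$ the tangent space, and $[T]=\{1,\dots,T\}$. For $f:\Delta_d\to\mathbb{R}$ differentiable on $\operatorname{ri}(\Delta_d)$ (within the affine hull of $\Delta_d$), $\nabla f(x)\in\Theta_d$ denotes the tangent gradient, i.e. the unique vector of $\Theta_d$ representing the differential of $f$ along directions in $\Theta_d$. The Kullback--Leibler divergence is $D_h(x,u):=\sum_{k\in\operatorname{supp}x}(x)_k\log\frac{(x)_k}{(u)_k}$ if $\operatorname{supp}x\subseteq\operatorname{supp}u$, and $+\infty$ otherwise ($x,u\in\Delta_d$). The class $\mathsf{Ent}_d(L)$ consists of all functions $f:\Delta_d\to\mathbb{R}$ that are convex, continuously differentiable on $\operatorname{ri}(\Delta_d)$, and satisfy, for all $(x,u)\in\Delta_d\times\operatorname{ri}(\Delta_d)$, $$0\le f(x)-f(u)-\langle\nabla f(u),x-u\rangle\le L\,D_h(x,u).$$ (Such functions are continuous on $\Delta_d$.) First-order oracle: $\mathscr{O}_f(x):=(f(x),\nabla f(x))\in\Omega:=\mathbb{R}\times\Theta_d$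 for $x\in\operatorname{ri}(\Delta_d)$. A deterministic $T$-step first-order method $\mathscr{M}\in\mathsf{FOM}_d(T)$ is a collection of arbitrary maps $\Phi_t:\Omega^{t-1}\to\operatorname{ri}(\Delta_d)$, $t\in[T]$, and $\bar\Phi_{T+1}:\Omega^T\to\Delta_d$ (with $\Omega^0$ a singleton). Run on $f$, it generates $x_1^{\mathscr M}=\Phi_1$, $x_t^{\mathscr M}(f)=\Phi_t(\mathscr{O}_f(x_1^{\mathscr M}),\dots,\mathscr{O}_f(x_{t-1}^{\mathscr M}(f)))$ for $2\le t\le T$, and outputs $x_{T+1}^{\mathscr M}(f)=\bar\Phi_{T+1}(\mathscr{O}_f(x_1^{\mathscr M}),\dots,\mathscr{O}_f(x_T^{\mathscr M}(f)))$. The minimax $T$-risk is $$\mathsf{Risk}_d(T,L):=\inf_{\mathscr{M}\in\mathsf{FOM}_d(T)}\ \sup_{f\in\mathsf{Ent}_d(L)}\Big\{f(x_{T+1}^{\mathscr M}(f))-\min_{x\in\Delta_d}f(x)\Big\}.$$ *)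

theory Defs
  imports "HOL-Analysis.Analysis"
begin

definition std_simplex :: "(real^'n) set" where
  "std_simplex = {x. (\<forall>k. 0 \<le> x $ k) \<and> (\<Sum>k\<in>UNIV. x $ k) = 1}"

(* 1 :: real^'n is the all-ones vector. *)
definition tangent_space :: "(real^'n) set" where
  "tangent_space = orthogonal_comp (span {1})"

(* Functions on the simplex are total functions on real^'n; differentiating "within std_simplex"
   makes their values off the simplex irrelevant.  Around a relative interior point the simplex
   and its affine hull coincide, so this is the derivative within the affine hull. *)
definition has_tangent_gradient :: "(real^'n \<Rightarrow> real) \<Rightarrow> real^'n \<Rightarrow> real^'n \<Rightarrow> bool" where
  "has_tangent_gradient f g u \<longleftrightarrow>
     g \<in> tangent_space \<and> (f has_derivative (\<lambda>v. g \<bullet> v)) (at u within std_simplex)"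

definition tangent_gradient :: "(real^'n \<Rightarrow> real) \<Rightarrow> real^'n \<Rightarrow> real^'n" where
  "tangent_gradient f u = (THE g. has_tangent_gradient f g u)"

definition supp :: "real^'n \<Rightarrow> 'n set" where
  "supp x = {k. x $ k \<noteq> 0}"

definition KL :: "real^'n \<Rightarrow> real^'n \<Rightarrow> ereal" where
  "KL x u = (if supp x \<subseteq> supp u
             then ereal (\<Sum>k\<in>supp x. x $ k * ln (x $ k / u $ k)) else \<infinity>)"

definition Ent :: "real \<Rightarrow> (real^'n \<Rightarrow> real) set" where
  "Ent L = {f. convex_on std_simplex f \<and>
     (\<forall>u\<in>rel_interior std_simplex. \<exists>g. has_tangent_gradient f g u) \<and>
     continuous_on (rel_interior std_simplex) (tangent_gradient f) \<and>
     (\<forall>x\<in>std_simplex. \<forall>u\<in>rel_interior std_simplex.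
        0 \<le> f x - f u - tangent_gradient f u \<bullet> (x - u) \<and>
        ereal (f x - f u - tangent_gradient f u \<bullet> (x - u)) \<le> ereal L * KL x u)}"

type_synonym 'n answer = "real \<times> (real^'n)"

definition fo_oracle :: "(real^'n \<Rightarrow> real) \<Rightarrow> real^'n \<Rightarrow> 'n answer" where
  "fo_oracle f x = (f x, tangent_gradient f x)"

definition answer_tuples :: "nat \<Rightarrow> 'n::finite answer list set" where
  "answer_tuples m = {as. length as = m \<and> set as \<subseteq> UNIV \<times> tangent_space}"

(* A T-step method is a pair of the query rules, indexed by t = 1, ..., T, and the output rule. *)
type_synonym 'n fom = "(nat \<Rightarrow> 'n answer list \<Rightarrow> real^'n) \<times> ('n answer list \<Rightarrow> real^'n)"

definition FOM :: "nat \<Rightarrow> 'n::finite fom set" where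
  "FOM T = {(\<Phi>, \<Phi>_out).
     (\<forall>t\<in>{1..T}. \<Phi> t \<in> answer_tuples (t - 1) \<rightarrow> rel_interior std_simplex) \<and>
     \<Phi>_out \<in> answer_tuples T \<rightarrow> std_simplex}"

primrec answers :: "'n::finite fom \<Rightarrow> (real^'n \<Rightarrow> real) \<Rightarrow> nat \<Rightarrow> 'n answer list" where
  "answers M f 0 = []"
| "answers M f (Suc t) = answers M f t @ [fo_oracle f (fst M (Suc t) (answers M f t))]"

definition query_point :: "'n::finite fom \<Rightarrow> (real^'n \<Rightarrow> real) \<Rightarrow> nat \<Rightarrow> real^'n" where
  "query_point M f t = fst M t (answers M f (t - 1))"

lemma answers_eq: "answers M f t = map (\<lambda>s. fo_oracle f (query_point M f s)) [1..<Suc t]"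
  by (induction t) (simp_all add: query_point_def)

definition output_point :: "nat \<Rightarrow> 'n::finite fom \<Rightarrow> (real^'n \<Rightarrow> real) \<Rightarrow> real^'n" where
  "output_point T M f = snd M (answers M f T)"

(* The infimum over the simplex is a minimum for the functions in Ent L, which are continuous
   on the compact simplex. *)
definition optimality_gap :: "(real^'n \<Rightarrow> real) \<Rightarrow> real^'n \<Rightarrow> ereal" where
  "optimality_gap f x = ereal (f x) - (INF y\<in>std_simplex. ereal (f y))"

(* The dimension d is CARD('n). *)
definition minimax_risk :: "'n::finite itself \<Rightarrow> nat \<Rightarrow> real \<Rightarrow> ereal" where
  "minimax_risk _ T L =
     (INF M\<in>(FOM T :: 'n fom set). SUP f\<in>Ent L. optimality_gap f (output_point T M f))"

lemma convex_std_simplex: "convex (std_simplex :: (real^'n) set)"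
  unfolding convex_def std_simplex_def
  by (auto simp: sum.distrib simp flip: sum_distrib_left)

lemma axis_in_std_simplex: "axis k 1 \<in> (std_simplex :: (real^'n) set)"
  by (simp add: std_simplex_def axis_def)

lemma mem_tangent_space: "v \<in> tangent_space \<longleftrightarrow> (\<Sum>k\<in>UNIV. v $ k) = 0"
  for v :: "real^'n"
proof -
  have "v \<in> tangent_space \<longleftrightarrow> (\<forall>c::real. c * (\<Sum>k\<in>UNIV. v $ k) = 0)"
    by (auto simp: tangent_space_def orthogonal_comp_def orthogonal_def span_singleton
        inner_vec_def sum_distrib_left)
  then show ?thesis by (metis mult_1 mult_zero_right)
qed

lemma rel_interior_std_simplex:
  "rel_interior std_simplex = {x :: real^'n. x \<in> std_simplex \<and> (\<forall>k. 0 < x $ k)}"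
proof (intro set_eqI iffI)
  fix z :: "real^'n"
  assume z: "z \<in> rel_interior std_simplex"
  have zs: "z \<in> std_simplex" using z rel_interior_subset by blast
  have "0 < z $ k" for k
  proof -
    obtain e where e: "e > 1" "(1 - e) *\<^sub>R axis k 1 + e *\<^sub>R z \<in> std_simplex"
      using z convex_rel_interior_iff[OF convex_std_simplex, of z] axis_in_std_simplex by blast
    then have "0 \<le> ((1 - e) *\<^sub>R axis k 1 + e *\<^sub>R z) $ k"
      unfolding std_simplex_def by blast
    then have "e * z $ k \<ge> e - 1" by (simp add: axis_def)
    then have "e * z $ k > 0" using e(1) by linarith
    then show ?thesis using e(1) by (simp add: zero_less_mult_iff)
  qed
  then show "z \<in> {x \<in> std_simplex. \<forall>k. 0 < x $ k}" using zs by simp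
next
  fix z :: "real^'n"
  assume "z \<in> {x \<in> std_simplex. \<forall>k. 0 < x $ k}"
  then have zs: "z \<in> std_simplex" and pos: "\<And>k. 0 < z $ k" by auto
  have "open (\<Inter>k. {x :: real^'n. 0 < x $ k})"
    by (intro open_INT ballI open_Collect_less continuous_intros) simp
  moreover have "affine hull std_simplex \<subseteq> {x :: real^'n. (\<Sum>k\<in>UNIV. x $ k) = 1}"
    by (rule hull_minimal)
      (auto simp: std_simplex_def affine_def sum.distrib simp flip: sum_distrib_left)
  ultimately show "z \<in> rel_interior std_simplex"
    unfolding mem_rel_interior using zs pos
    by (intro exI[of _ "\<Inter>k. {x :: real^'n. 0 < x $ k}"])
      (auto simp: std_simplex_def intro: less_imp_le)
qed

lemma tangent_gradient_eqI:
  fixes f :: "real^'n \<Rightarrow> real"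
  assumes u: "u \<in> rel_interior std_simplex" and g: "has_tangent_gradient f g u"
  shows "tangent_gradient f u = g"
  unfolding tangent_gradient_def
proof (rule the_equality)
  show "has_tangent_gradient f g u" by (rule g)
next
  fix h assume h: "has_tangent_gradient f h u"
  define v where "v = h - g"
  have v0: "(\<Sum>k\<in>UNIV. v $ k) = 0"
    using g h by (auto simp: has_tangent_gradient_def mem_tangent_space v_def sum_subtractf)
  have pos: "\<And>k. 0 < u $ k" and u1: "(\<Sum>k\<in>UNIV. u $ k) = 1"
    using u unfolding rel_interior_std_simplex by (auto simp: std_simplex_def)
  have "\<forall>\<^sub>F t in at (0::real). \<forall>k. 0 < (u + t *\<^sub>R v) $ k"
  proof (rule eventually_all_finite)
    fix k
    have "((\<lambda>t. (u + t *\<^sub>R v) $ k) \<longlongrightarrow> (u + 0 *\<^sub>R v) $ k) (at (0::real))"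
      by (intro tendsto_intros)
    then show "\<forall>\<^sub>F t in at (0::real). 0 < (u + t *\<^sub>R v) $ k"
      using pos[of k] by (intro order_tendstoD(1)) auto
  qed
  then have "\<forall>\<^sub>F t in at (0::real). u + t *\<^sub>R v \<in> std_simplex"
    by eventually_elim
      (auto simp: std_simplex_def sum.distrib u1 v0 less_imp_le simp flip: sum_distrib_left)
  then obtain e where e: "e > 0" "\<And>t. t \<noteq> 0 \<Longrightarrow> \<bar>t\<bar> < e \<Longrightarrow> u + t *\<^sub>R v \<in> std_simplex"
    unfolding eventually_at by (auto simp: dist_real_def)
  have im: "(\<lambda>t. u + t *\<^sub>R v) ` {-e<..<e} \<subseteq> std_simplex"
  proof clarify
    fix t assume "t \<in> {-e<..<e}"
    then show "u + t *\<^sub>R v \<in> std_simplex"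
      using e(2)[of t] u rel_interior_subset[of "std_simplex :: (real^'n) set"]
      by (cases "t = 0") auto
  qed
  have der: "((\<lambda>t. f (u + t *\<^sub>R v)) has_derivative (\<lambda>t. w \<bullet> (t *\<^sub>R v))) (at 0)"
    if "has_tangent_gradient f w u" for w
  proof -
    have "(f has_derivative (\<lambda>v. w \<bullet> v))
            (at (u + 0 *\<^sub>R v) within (\<lambda>t. u + t *\<^sub>R v) ` {-e<..<e})"
      using that im by (auto simp: has_tangent_gradient_def intro: has_derivative_subset)
    moreover have "((\<lambda>t. u + t *\<^sub>R v) has_derivative (\<lambda>t. t *\<^sub>R v)) (at 0 within {-e<..<e})"
      by (auto intro!: derivative_eq_intros)
    ultimately have "((\<lambda>t. f (u + t *\<^sub>R v)) has_derivative (\<lambda>t. w \<bullet> (t *\<^sub>R v)))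
        (at 0 within {-e<..<e})"
      using has_derivative_in_compose by blast
    then show ?thesis using e(1) by (simp add: at_within_open[of 0 "{-e<..<e}"])
  qed
  have "g \<bullet> v = h \<bullet> v"
    using has_derivative_unique[OF der[OF g] der[OF h], THEN fun_cong, of 1] by simp
  then have "v \<bullet> v = 0" by (simp add: v_def inner_diff_left)
  then show "h = g" by (simp add: v_def)
qed

end

theory Submission
  imports Defs
begin

text \<open>
  Put \<open>N = T + 1\<close>. The hard functions are maxima of linear functions of \<open>x\<close>: a player splits a unit
  budget \<open>q\<close> over the coordinates, and
  \<open>f_a(x) = L max_q \<Sum>_k (x_k ln (1 - q_k / 2) - a_k q_k)\<close>.
  Both terms are costs to the player, so minimizing \<open>f_a\<close> means making every split expensive; a
  coordinate with little mass \<open>x_k\<close> and a small weight \<open>a_k\<close> is a cheap place to spend the budget.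

  \<^item> Every \<open>f_a\<close> is in \<open>Ent L\<close> (\<open>hard_fun_in_Ent\<close>). A best response \<open>q\<close> at \<open>u\<close> gives the
    subgradient with entries \<open>L ln (1 - q_k / 2)\<close>, so the Bregman divergence is nonnegative. For the
    upper bound, let \<open>q'\<close> be a best response at \<open>x\<close> and \<open>\<rho>_k = (2 - q'_k) / (2 - q_k)\<close>. By the
    first-order optimality of \<open>q\<close>, the divergence is at most
    \<open>L \<Sum>_k (x_k ln \<rho>_k + u_k (1 - \<rho>_k))\<close>, and the supremum of this over all \<open>\<rho> > 0\<close> is exactly
    \<open>L\<close> times the Kullback--Leibler divergence. Differentiability and continuity of the gradient
    then follow from these two bounds, because the divergence is quadratically small near \<open>u\<close>.

  \<^item> Coordinates can be hidden (\<open>best_response_dominated_eq_0\<close>). A log term has slope between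
    \<open>x_k / 2\<close> and \<open>x_k\<close>, so no budget goes to \<open>k\<close> if some \<open>j\<close> has
    \<open>a_j + x_j \<le> a_k + x_k / 2\<close>. Then neither value nor gradient at \<open>x\<close> depends on \<open>a_k\<close>.

  \<^item> The adversary answers the \<open>i\<close>-th query by revealing its smallest coordinate among those not yet
    revealed, which is at most \<open>1 / (8 N^2)\<close> since at least \<open>8 N^2\<close> coordinates are left.
    Counting from \<open>i = 0\<close>, its weight is \<open>i / (16 N^2)\<close>, and the weight of unrevealed coordinates is
    \<open>1 / (2 N)\<close>. The step \<open>1 / (16 N^2)\<close> is what hiding the later coordinates requires, so
    the answers do not change when further coordinates are revealed
    (\<open>answers_snoc_unchanged\<close>).

  \<^item> The output is treated like one more query, revealing an \<open>N\<close>-th coordinate \<open>j\<close>. Spending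
    the whole budget on \<open>j\<close> shows that the output has value at least \<open>- 3 L / (16 N)\<close>. The uniform
    distribution on the \<open>N\<close> revealed coordinates has value at most \<open>- L / (2 N)\<close>, as every
    coordinate then costs at least \<open>1 / (2 N)\<close> per unit of budget, through its mass or through its
    weight. Hence the gap is at least \<open>5 L / (16 N)\<close>, uniformly over all methods.
\<close>

section \<open>The simplex\<close>

lemma std_simplexD:
  fixes x :: "real^'n"
  assumes "x \<in> std_simplex"
  shows "0 \<le> x $ k" and "x $ k \<le> 1" and "(\<Sum>k\<in>UNIV. x $ k) = 1"
proof -
  show nn: "0 \<le> x $ k" for k using assms by (simp add: std_simplex_def)
  show s: "(\<Sum>k\<in>UNIV. x $ k) = 1" using assms by (simp add: std_simplex_def)
  have "x $ k \<le> (\<Sum>k\<in>UNIV. x $ k)" by (rule member_le_sum) (auto simp: nn)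
  then show "x $ k \<le> 1" using s by simp
qed

lemma compact_std_simplex: "compact (std_simplex :: (real^'n) set)"
proof -
  have "std_simplex = (\<Inter>k. {x :: real^'n. 0 \<le> x $ k}) \<inter> {x. (\<Sum>k\<in>UNIV. x $ k) = 1}"
    by (auto simp: std_simplex_def)
  moreover have "closed \<dots>"
    by (intro closed_Int closed_INT ballI closed_Collect_le closed_Collect_eq continuous_intros)
  moreover have "(std_simplex :: (real^'n) set) \<subseteq> cbox 0 1"
    using std_simplexD by (auto simp: mem_box_cart)
  ultimately show ?thesis
    by (metis bounded_cbox bounded_subset compact_eq_bounded_closed)
qed

lemma rel_interior_std_simplexD:
  fixes u :: "real^'n"
  assumes "u \<in> rel_interior std_simplex"
  shows "u \<in> std_simplex" and "0 < u $ k"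
  using assms by (auto simp: rel_interior_std_simplex)

section \<open>Functions squeezed between their tangent planes and the divergence\<close>

text \<open>Orthogonal projection onto the tangent space.\<close>

definition tangent_part :: "real^'n \<Rightarrow> real^'n" where
  "tangent_part v = v - ((\<Sum>k\<in>UNIV. v $ k) / CARD('n)) *\<^sub>R 1"

lemma tangent_part_in_tangent_space: "tangent_part v \<in> tangent_space"
  by (simp add: mem_tangent_space tangent_part_def sum_subtractf)

lemma inner_tangent_part:
  fixes x u v :: "real^'n"
  assumes "x \<in> std_simplex" "u \<in> std_simplex"
  shows "tangent_part v \<bullet> (x - u) = v \<bullet> (x - u)"
proof -
  have "1 \<bullet> (x - u) = 0"
    using std_simplexD(3)[OF assms(1)] std_simplexD(3)[OF assms(2)]
    by (simp add: inner_vec_def sum_subtractf)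
  then show ?thesis by (simp add: tangent_part_def inner_diff_left)
qed

definition real_KL :: "real^'n \<Rightarrow> real^'n \<Rightarrow> real" where
  "real_KL x u = (\<Sum>k\<in>UNIV. x $ k * ln (x $ k / u $ k))"

lemma KL_eq_real_KL:
  assumes "u \<in> rel_interior std_simplex"
  shows "KL x u = ereal (real_KL x u)"
proof -
  have "supp u = UNIV"
    using rel_interior_std_simplexD(2)[OF assms] by (auto simp: supp_def less_le)
  moreover have "(\<Sum>k\<in>supp x. x $ k * ln (x $ k / u $ k)) = real_KL x u"
    unfolding real_KL_def by (rule sum.mono_neutral_left) (auto simp: supp_def)
  ultimately show ?thesis by (simp add: KL_def)
qed

text \<open>The Kullback--Leibler divergence is bounded by the \<open>\<chi>\<^sup>2\<close> divergence, via \<open>ln z \<le> z - 1\<close>.\<close>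

lemma real_KL_le_quadratic:
  fixes u :: "real^'n"
  assumes u: "u \<in> rel_interior std_simplex"
  obtains C where "C > 0" "\<And>x. x \<in> std_simplex \<Longrightarrow> real_KL x u \<le> C * (norm (x - u))\<^sup>2"
proof
  let ?C = "\<Sum>k\<in>UNIV. 1 / u $ k"
  note us = rel_interior_std_simplexD[OF u]
  show "?C > 0" by (intro sum_pos) (auto simp: us)
  fix x :: "real^'n" assume x: "x \<in> std_simplex"
  have "real_KL x u \<le> (\<Sum>k\<in>UNIV. x $ k * (x $ k / u $ k - 1))"
    unfolding real_KL_def
  proof (rule sum_mono)
    fix k
    show "x $ k * ln (x $ k / u $ k) \<le> x $ k * (x $ k / u $ k - 1)"
    proof (cases "x $ k = 0")
      case False
      then have "0 < x $ k" using std_simplexD(1)[OF x, of k] by simp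
      then show ?thesis using us(2)[of k] by (intro mult_left_mono ln_le_minus_one) auto
    qed simp
  qed
  also have "\<dots> = (\<Sum>k\<in>UNIV. (x $ k - u $ k)\<^sup>2 / u $ k + (x $ k - u $ k))"
  proof (rule sum.cong[OF refl])
    fix k
    show "x $ k * (x $ k / u $ k - 1) = (x $ k - u $ k)\<^sup>2 / u $ k + (x $ k - u $ k)"
      using us(2)[of k] by (simp add: field_simps power2_eq_square)
  qed
  also have "\<dots> = (\<Sum>k\<in>UNIV. (x $ k - u $ k)\<^sup>2 * (1 / u $ k))"
    using std_simplexD(3)[OF x] std_simplexD(3)[OF us(1)]
    by (simp add: sum.distrib sum_subtractf)
  also have "\<dots> \<le> (\<Sum>k\<in>UNIV. (norm (x - u))\<^sup>2 * (1 / u $ k))"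
  proof (intro sum_mono mult_right_mono)
    fix k
    have "\<bar>(x - u) $ k\<bar> \<le> norm (x - u)" by (rule component_le_norm_cart)
    then show "(x $ k - u $ k)\<^sup>2 \<le> (norm (x - u))\<^sup>2"
      by (metis abs_le_square_iff abs_norm_cancel vector_minus_component)
  qed (use us(2) in \<open>simp add: less_imp_le\<close>)
  finally show "real_KL x u \<le> ?C * (norm (x - u))\<^sup>2"
    by (simp only: mult.commute[of ?C] sum_distrib_left)
qed

text \<open>The linearization error lies between \<open>0\<close> and a quadratic, so a vector satisfying both bounds is a
  gradient up to its normal component.\<close>

lemma has_tangent_gradient_if_relatively_smooth:
  fixes f :: "real^'n \<Rightarrow> real"
  assumes "L > 0" and u: "u \<in> rel_interior std_simplex"
    and lower: "\<And>x. x \<in> std_simplex \<Longrightarrow> 0 \<le> f x - f u - g \<bullet> (x - u)"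
    and upper: "\<And>x. x \<in> std_simplex \<Longrightarrow> f x - f u - g \<bullet> (x - u) \<le> L * real_KL x u"
  shows "has_tangent_gradient f (tangent_part g) u"
  unfolding has_tangent_gradient_def
proof (intro conjI tangent_part_in_tangent_space)
  note us = rel_interior_std_simplexD(1)[OF u]
  obtain C where C: "C > 0" "\<And>x. x \<in> std_simplex \<Longrightarrow> real_KL x u \<le> C * (norm (x - u))\<^sup>2"
    using real_KL_le_quadratic[OF u] by blast
  show "(f has_derivative (\<lambda>v. tangent_part g \<bullet> v)) (at u within std_simplex)"
  proof (rule has_derivativeI_sandwich[where e = 1 and H = "\<lambda>x. L * C * norm (x - u)"])
    show "bounded_linear (\<lambda>v. tangent_part g \<bullet> v)" by (rule bounded_linear_inner_right)
    have "((\<lambda>x. L * C * norm (x - u)) \<longlongrightarrow> L * C * norm (u - u)) (at u within std_simplex)"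
      by (intro tendsto_intros)
    then show "((\<lambda>x. L * C * norm (x - u)) \<longlongrightarrow> 0) (at u within std_simplex)" by simp
  next
    fix x :: "real^'n" assume x: "x \<in> std_simplex" "x \<noteq> u"
    have "f x - f u - g \<bullet> (x - u) \<le> L * (C * (norm (x - u))\<^sup>2)"
      using upper[OF x(1)] C(2)[OF x(1)] \<open>L > 0\<close>
      by (meson less_eq_real_def mult_left_mono order_trans)
    then show "norm (f x - f u - tangent_part g \<bullet> (x - u)) / norm (x - u) \<le> L * C * norm (x - u)"
      using lower[OF x(1)] x(2)
      by (simp add: inner_tangent_part[OF x(1) us] field_simps power2_eq_square)
  qed simp
qed

text \<open>The gradient is locally Lipschitz. For \<open>y\<close> near \<open>u\<close>, compare the tangent planes at both points at
  the point \<open>x\<close> reached from \<open>y\<close> by a step of length \<open>r = norm (y - u)\<close> in the direction of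
  \<open>w = G y - G u\<close>: the plane of \<open>y\<close> lies below \<open>f\<close>, which exceeds the plane of \<open>u\<close> by only \<open>O(r\<^sup>2)\<close>,
  whereas the planes drift apart by \<open>r * norm w\<close>.\<close>

lemma continuous_on_tangent_gradient_if_relatively_smooth:
  fixes f :: "real^'n \<Rightarrow> real"
  assumes "L > 0"
    and grad: "\<And>u. u \<in> rel_interior std_simplex \<Longrightarrow> has_tangent_gradient f (G u) u"
    and lower: "\<And>x u. x \<in> std_simplex \<Longrightarrow> u \<in> rel_interior std_simplex \<Longrightarrow>
                  0 \<le> f x - f u - G u \<bullet> (x - u)"
    and upper: "\<And>x u. x \<in> std_simplex \<Longrightarrow> u \<in> rel_interior std_simplex \<Longrightarrow>
                  f x - f u - G u \<bullet> (x - u) \<le> L * real_KL x u"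
  shows "continuous_on (rel_interior std_simplex) G"
  unfolding continuous_on_def
proof
  fix u :: "real^'n" assume u: "u \<in> rel_interior std_simplex"
  note us = rel_interior_std_simplexD[OF u]
  obtain C where C: "C > 0" "\<And>x. x \<in> std_simplex \<Longrightarrow> real_KL x u \<le> C * (norm (x - u))\<^sup>2"
    using real_KL_le_quadratic[OF u] by blast
  \<comment> \<open>Points within distance \<open>m\<close> of \<open>u\<close> on the affine hull stay in the simplex.\<close>
  define m where "m = Min (range (\<lambda>k. u $ k))"
  have m: "m > 0" "\<And>k. m \<le> u $ k"
    by (auto simp: m_def us(2))
  have lip: "norm (G y - G u) \<le> 4 * L * C * norm (y - u)"
    if y: "y \<in> rel_interior std_simplex" "dist y u < m / 2" for y
  proof (cases "y = u \<or> G y = G u")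
    case False
    define w where "w = G y - G u"
    define r where "r = norm (y - u)"
    define x where "x = y + (r / norm w) *\<^sub>R w"
    have w: "norm w > 0" and r: "r > 0" using False by (auto simp: w_def r_def)
    have r2: "r < m / 2" using y(2) by (simp add: r_def dist_norm)
    have nx: "norm (x - y) = r" using w r by (simp add: x_def)
    have tw: "(\<Sum>k\<in>UNIV. w $ k) = 0"
      using grad[OF u] grad[OF y(1)]
      by (auto simp: has_tangent_gradient_def mem_tangent_space w_def sum_subtractf)
    have nxu: "norm (x - u) \<le> 2 * r"
      using norm_triangle_ineq[of "x - y" "y - u"] nx by (simp add: r_def)
    have x: "x \<in> std_simplex"
      unfolding std_simplex_def
    proof (intro CollectI conjI allI)
      fix k
      have "\<bar>(x - u) $ k\<bar> \<le> norm (x - u)" by (rule component_le_norm_cart)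
      then show "0 \<le> x $ k" using nxu r2 m(2)[of k] by simp
    next
      show "(\<Sum>k\<in>UNIV. x $ k) = 1"
        using std_simplexD(3)[OF rel_interior_std_simplexD(1)[OF y(1)]] tw
        by (simp only: x_def vector_add_component vector_scaleR_component sum.distrib
            real_scaleR_def mult_zero_right add_0_right flip: sum_distrib_left)
    qed
    have ys: "y \<in> std_simplex" by (rule rel_interior_std_simplexD(1)[OF y(1)])
    have "w \<bullet> (x - y) = r * norm w"
      using w by (simp add: x_def power2_eq_square flip: power2_norm_eq_inner)
    moreover have "w \<bullet> (x - y) \<le> L * real_KL x u"
      using lower[OF x y(1)] upper[OF x u] lower[OF ys u]
      by (simp add: w_def inner_diff_left inner_diff_right)
    moreover have "L * real_KL x u \<le> L * (C * (2 * r)\<^sup>2)"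
    proof -
      have "real_KL x u \<le> C * (norm (x - u))\<^sup>2" by (rule C(2)[OF x])
      also have "\<dots> \<le> C * (2 * r)\<^sup>2"
        using C(1) nxu by (intro mult_left_mono power_mono) auto
      finally show ?thesis using \<open>L > 0\<close> by simp
    qed
    ultimately have "r * norm w \<le> r * (4 * L * C * r)"
      by (simp add: power2_eq_square algebra_simps)
    then have "norm w \<le> 4 * L * C * r" using r by simp
    then show ?thesis by (simp add: w_def r_def)
  next
    case True
    then show ?thesis using \<open>L > 0\<close> C(1) by auto
  qed
  have "((\<lambda>y. 4 * L * C * norm (y - u)) \<longlongrightarrow> 4 * L * C * norm (u - u))
          (at u within rel_interior std_simplex)"
    by (intro tendsto_intros)
  then have lim: "((\<lambda>y. 4 * L * C * norm (y - u)) \<longlongrightarrow> 0) (at u within rel_interior std_simplex)"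
    by simp
  have "\<forall>\<^sub>F y in at u within rel_interior std_simplex. norm (G y - G u) \<le> 4 * L * C * norm (y - u)"
    unfolding eventually_at using m(1) lip by (intro exI[of _ "m / 2"]) auto
  then have "((\<lambda>y. G y - G u) \<longlongrightarrow> 0) (at u within rel_interior std_simplex)"
    by (rule Lim_null_comparison[OF _ lim])
  then show "(G \<longlongrightarrow> G u) (at u within rel_interior std_simplex)"
    by (rule LIM_zero_cancel)
qed

lemma Ent_if_relatively_smooth:
  fixes f :: "real^'n \<Rightarrow> real"
  assumes "L > 0" and conv: "convex_on std_simplex f"
    and lower: "\<And>x u. x \<in> std_simplex \<Longrightarrow> u \<in> rel_interior std_simplex \<Longrightarrow>
                  0 \<le> f x - f u - g u \<bullet> (x - u)"
    and upper: "\<And>x u. x \<in> std_simplex \<Longrightarrow> u \<in> rel_interior std_simplex \<Longrightarrow>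
                  f x - f u - g u \<bullet> (x - u) \<le> L * real_KL x u"
  shows "f \<in> Ent L"
proof -
  let ?R = "rel_interior std_simplex :: (real^'n) set"
  have G: "has_tangent_gradient f (tangent_part (g u)) u" if "u \<in> ?R" for u
    using \<open>L > 0\<close> that lower upper by (intro has_tangent_gradient_if_relatively_smooth)
  have tg: "tangent_gradient f u = tangent_part (g u)" if "u \<in> ?R" for u
    using that G by (intro tangent_gradient_eqI)
  have inner: "tangent_part (g u) \<bullet> (x - u) = g u \<bullet> (x - u)"
    if "x \<in> std_simplex" "u \<in> ?R" for x u
    using that rel_interior_std_simplexD(1) by (intro inner_tangent_part)
  have "continuous_on ?R (\<lambda>u. tangent_part (g u))"
    using \<open>L > 0\<close> G lower upper
    by (intro continuous_on_tangent_gradient_if_relatively_smooth[where f = f and L = L])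
      (auto simp: inner)
  then have "continuous_on ?R (tangent_gradient f)"
    by (rule continuous_on_eq) (simp add: tg)
  then show ?thesis
    using conv G lower upper by (auto simp: Ent_def tg inner KL_eq_real_KL)
qed

section \<open>The hard functions\<close>

text \<open>The factor \<open>1 / 2\<close> keeps the argument of the logarithm in \<open>[1/2, 1]\<close>, so that the payoff is
  smooth in \<open>q\<close> up to the boundary of the simplex and best responses exist for every \<open>x\<close>, including
  those with zero entries.\<close>

definition payoff :: "real^'n \<Rightarrow> real^'n \<Rightarrow> real^'n \<Rightarrow> real" where
  "payoff a x q = (\<Sum>k\<in>UNIV. x $ k * ln (1 - q $ k / 2) - a $ k * q $ k)"

definition best_response :: "real^'n \<Rightarrow> real^'n \<Rightarrow> real^'n \<Rightarrow> bool" where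
  "best_response a x q \<longleftrightarrow>
     q \<in> std_simplex \<and> (\<forall>q'\<in>std_simplex. payoff a x q' \<le> payoff a x q)"

definition hard_fun :: "real \<Rightarrow> real^'n \<Rightarrow> real^'n \<Rightarrow> real" where
  "hard_fun L a x = L * (SUP q\<in>std_simplex. payoff a x q)"

text \<open>The gradient of the linear function \<open>x \<mapsto> L * payoff a x q\<close>.\<close>

definition hard_slope :: "real \<Rightarrow> real^'n \<Rightarrow> real^'n" where
  "hard_slope L q = (\<chi> k. L * ln (1 - q $ k / 2))"

lemma hard_fun_eq_payoff: "best_response a x q \<Longrightarrow> hard_fun L a x = L * payoff a x q"
  unfolding hard_fun_def best_response_def
  by (intro arg_cong[where f = "(*) L"] cSup_eq_maximum) auto

lemma best_response_exists: "\<exists>q. best_response a (x :: real^'n) q"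
proof -
  have "continuous_on std_simplex (payoff a x)"
    unfolding payoff_def
  proof (intro continuous_intros ballI)
    fix q :: "real^'n" and k assume "q \<in> std_simplex"
    then have "q $ k \<le> 1" by (rule std_simplexD)
    then show "1 - q $ k / 2 \<noteq> 0" by simp
  qed simp
  moreover have "(std_simplex :: (real^'n) set) \<noteq> {}" using axis_in_std_simplex by blast
  ultimately show ?thesis
    using continuous_attains_sup[OF compact_std_simplex] unfolding best_response_def by blast
qed

lemma payoff_change_point:
  "L * payoff a x q = L * payoff a u q + hard_slope L q \<bullet> (x - u)"
  unfolding payoff_def hard_slope_def inner_vec_def sum_distrib_left sum.distrib[symmetric]
  by (rule sum.cong) (auto simp: algebra_simps)

text \<open>First-order optimality: otherwise a small step from \<open>q\<close> towards \<open>q'\<close> would increase the payoff.\<close>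

lemma best_response_variational:
  fixes a u q q' :: "real^'n"
  assumes best: "best_response a u q" and q': "q' \<in> std_simplex"
  shows "0 \<le> (\<Sum>k\<in>UNIV. (u $ k / (2 - q $ k) + a $ k) * (q' $ k - q $ k))"
proof (rule ccontr)
  assume neg: "\<not> ?thesis"
  have q: "q \<in> std_simplex" using best by (simp add: best_response_def)
  let ?\<phi> = "\<lambda>\<tau>. payoff a u (q + \<tau> *\<^sub>R (q' - q))"
  let ?D = "\<Sum>k\<in>UNIV. - ((u $ k / (2 - q $ k) + a $ k) * (q' $ k - q $ k))"
  have "(?\<phi> has_real_derivative ?D) (at 0)"
    unfolding payoff_def
  proof (rule DERIV_sum)
    fix k
    have "q $ k \<le> 1" using q by (rule std_simplexD)
    then show "((\<lambda>\<tau>. u $ k * ln (1 - (q + \<tau> *\<^sub>R (q' - q)) $ k / 2)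
        - a $ k * (q + \<tau> *\<^sub>R (q' - q)) $ k)
      has_real_derivative - ((u $ k / (2 - q $ k) + a $ k) * (q' $ k - q $ k))) (at 0)"
      by (auto intro!: derivative_eq_intros simp: field_simps)
  qed
  moreover have "?D > 0" using neg by (simp add: sum_negf)
  ultimately obtain d where d: "d > 0" "\<And>h. 0 < h \<Longrightarrow> h < d \<Longrightarrow> ?\<phi> 0 < ?\<phi> (0 + h)"
    using DERIV_pos_inc_right by blast
  define h where "h = min (d / 2) 1"
  have h: "0 < h" "h < d" "h \<le> 1" using d(1) by (auto simp: h_def)
  have "q + h *\<^sub>R (q' - q) = (1 - h) *\<^sub>R q + h *\<^sub>R q'" by (simp add: algebra_simps)
  also have "\<dots> \<in> std_simplex"
    by (rule convexD[OF convex_std_simplex q q']) (use h in auto)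
  finally have "?\<phi> h \<le> payoff a u q" using best by (simp add: best_response_def)
  then show False using d(2)[OF h(1,2)] by simp
qed

lemma hard_fun_bregman_lower:
  fixes a x u q :: "real^'n"
  assumes "L > 0" and best: "best_response a u q"
  shows "0 \<le> hard_fun L a x - hard_fun L a u - hard_slope L q \<bullet> (x - u)"
proof -
  obtain q' where q': "best_response a x q'" using best_response_exists by blast
  have "payoff a x q \<le> payoff a x q'"
    using best q' by (simp add: best_response_def)
  then have "L * payoff a x q \<le> L * payoff a x q'" using \<open>L > 0\<close> by simp
  then show ?thesis
    unfolding hard_fun_eq_payoff[OF q'] hard_fun_eq_payoff[OF best] payoff_change_point[of L a x q u]
    by simp
qed

text \<open>One coordinate of the upper Bregman bound. With \<open>\<rho> = (2 - q') / (2 - q)\<close> it reduces to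
  \<open>x ln \<rho> + u (1 - \<rho>) \<le> x ln (x / u) + u - x\<close>; for \<open>x > 0\<close> the left-hand side is maximal at \<open>\<rho> = x / u\<close>. The
  subtracted product is the summand of the variational inequality, so it disappears after
  summation.\<close>

lemma log_gain_le_KL_term:
  fixes x u q q' :: real
  assumes "0 \<le> x" "0 < u" "q \<le> 1" "q' \<le> 1"
  shows "x * ln (1 - q' / 2) - a * q'
    \<le> x * ln (1 - q / 2) - a * q - (u / (2 - q) + a) * (q' - q) + x * ln (x / u) + u - x"
proof -
  define \<rho> where "\<rho> = (2 - q') / (2 - q)"
  have \<rho>: "\<rho> > 0" using assms by (simp add: \<rho>_def)
  have ln: "ln (1 - q' / 2) = ln (1 - q / 2) + ln \<rho>"
  proof -
    have "1 - q' / 2 = (1 - q / 2) * \<rho>" using assms by (simp add: \<rho>_def field_simps)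
    then show ?thesis using \<rho> assms by (simp add: ln_mult)
  qed
  have "u / (2 - q) * (q' - q) = u * (1 - \<rho>)" using assms by (simp add: \<rho>_def field_simps)
  moreover have "x * ln \<rho> + u * (1 - \<rho>) \<le> x * ln (x / u) + u - x"
  proof (cases "x = 0")
    case True
    then show ?thesis using assms \<rho> by (simp add: algebra_simps)
  next
    case False
    then have x: "x > 0" using assms by simp
    have "x * ln (\<rho> * u / x) \<le> x * (\<rho> * u / x - 1)"
      using x \<rho> assms by (intro mult_left_mono ln_le_minus_one) auto
    also have "\<dots> = \<rho> * u - x" using x by (simp add: field_simps)
    finally show ?thesis
      using x \<rho> assms by (simp add: ln_mult ln_div algebra_simps)
  qed
  ultimately show ?thesis by (simp add: ln algebra_simps)
qed

lemma hard_fun_bregman_upper: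
  fixes a x u q :: "real^'n"
  assumes "L > 0" and x: "x \<in> std_simplex" and u: "u \<in> rel_interior std_simplex"
    and best: "best_response a u q"
  shows "hard_fun L a x - hard_fun L a u - hard_slope L q \<bullet> (x - u) \<le> L * real_KL x u"
proof -
  note us = rel_interior_std_simplexD[OF u]
  have q: "q \<in> std_simplex" using best by (simp add: best_response_def)
  obtain q' where q': "best_response a x q'" using best_response_exists by blast
  then have q's: "q' \<in> std_simplex" by (simp add: best_response_def)
  have "payoff a x q' \<le> (\<Sum>k\<in>UNIV. x $ k * ln (1 - q $ k / 2) - a $ k * q $ k
      - (u $ k / (2 - q $ k) + a $ k) * (q' $ k - q $ k)
      + x $ k * ln (x $ k / u $ k) + u $ k - x $ k)"
    unfolding payoff_def
    using std_simplexD[OF q] std_simplexD[OF q's] std_simplexD[OF x] us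
    by (intro sum_mono log_gain_le_KL_term) auto
  also have "\<dots> = payoff a x q
      - (\<Sum>k\<in>UNIV. (u $ k / (2 - q $ k) + a $ k) * (q' $ k - q $ k)) + real_KL x u"
    using std_simplexD(3)[OF x] std_simplexD(3)[OF us(1)]
    by (simp add: payoff_def real_KL_def sum.distrib sum_subtractf)
  also have "\<dots> \<le> payoff a x q + real_KL x u"
    using best_response_variational[OF best q's] by simp
  finally have "L * payoff a x q' \<le> L * payoff a x q + L * real_KL x u"
    using \<open>L > 0\<close> by (simp flip: distrib_left)
  then show ?thesis
    using payoff_change_point[of L a x q u]
    by (simp add: hard_fun_eq_payoff[OF q'] hard_fun_eq_payoff[OF best])
qed

lemma convex_on_hard_fun:
  fixes a :: "real^'n"
  assumes "L > 0"
  shows "convex_on std_simplex (hard_fun L a)"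
proof (rule convex_onI[OF _ convex_std_simplex])
  fix t :: real and x y :: "real^'n" assume t: "0 < t" "t < 1"
  let ?z = "(1 - t) *\<^sub>R x + t *\<^sub>R y"
  obtain q where q: "best_response a ?z q" using best_response_exists by blast
  let ?l = "\<lambda>w. hard_fun L a ?z + hard_slope L q \<bullet> (w - ?z)"
  have l: "?l w \<le> hard_fun L a w" for w
    using hard_fun_bregman_lower[OF \<open>L > 0\<close> q, of w] by simp
  have "hard_fun L a ?z = (1 - t) * ?l x + t * ?l y"
    by (simp add: algebra_simps inner_simps)
  also have "\<dots> \<le> (1 - t) * hard_fun L a x + t * hard_fun L a y"
    using t l by (intro add_mono mult_left_mono) auto
  finally show "hard_fun L a ?z \<le> (1 - t) * hard_fun L a x + t * hard_fun L a y" .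
qed

lemma hard_fun_in_Ent:
  fixes a :: "real^'n"
  assumes "L > 0"
  shows "hard_fun L a \<in> Ent L"
proof -
  define q where "q = (\<lambda>u. SOME q. best_response a u q)"
  have q: "best_response a u (q u)" for u
    unfolding q_def by (rule someI_ex[OF best_response_exists])
  show ?thesis
    using assms q hard_fun_bregman_lower hard_fun_bregman_upper convex_on_hard_fun
    by (intro Ent_if_relatively_smooth[where g = "\<lambda>u. hard_slope L (q u)"]) blast+
qed

lemma fo_oracle_hard_fun:
  fixes a x q :: "real^'n"
  assumes "L > 0" and x: "x \<in> rel_interior std_simplex" and best: "best_response a x q"
  shows "fo_oracle (hard_fun L a) x = (L * payoff a x q, tangent_part (hard_slope L q))"
proof -
  have "has_tangent_gradient (hard_fun L a) (tangent_part (hard_slope L q)) x"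
    using assms hard_fun_bregman_lower hard_fun_bregman_upper
    by (intro has_tangent_gradient_if_relatively_smooth) blast+
  then show ?thesis
    using x by (simp add: fo_oracle_def hard_fun_eq_payoff[OF best] tangent_gradient_eqI)
qed

section \<open>Coordinates hidden from the oracle\<close>

text \<open>If \<open>q\<close> spent anything on \<open>k\<close>, moving that amount to \<open>j\<close> would be an improvement: the marginal
  cost at \<open>k\<close> exceeds \<open>a $ k + x $ k / 2\<close>, and at \<open>j\<close>, where \<open>q $ j < 1\<close>, it is below
  \<open>a $ j + x $ j\<close>.\<close>

lemma best_response_dominated_eq_0:
  fixes a x q :: "real^'n"
  assumes x: "x \<in> rel_interior std_simplex" and best: "best_response a x q"
    and "k \<noteq> j" and dom: "a $ j + x $ j \<le> a $ k + x $ k / 2"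
  shows "q $ k = 0"
proof (rule ccontr)
  assume "q $ k \<noteq> 0"
  note xs = rel_interior_std_simplexD[OF x]
  have q: "q \<in> std_simplex" using best by (simp add: best_response_def)
  note qs = std_simplexD[OF q]
  have k: "q $ k > 0" using \<open>q $ k \<noteq> 0\<close> qs(1)[of k] by simp
  have "q $ j + q $ k \<le> 1"
  proof -
    have "(\<Sum>i\<in>{j, k}. q $ i) \<le> (\<Sum>i\<in>UNIV. q $ i)"
      by (intro sum_mono2) (auto simp: qs)
    then show ?thesis using \<open>k \<noteq> j\<close> qs(3) by simp
  qed
  then have j: "q $ j < 1" using k by simp
  define q' where "q' = q + q $ k *\<^sub>R (axis j 1 - axis k 1)"
  have q'_nth: "q' $ i - q $ i = (if i = j then q $ k else 0) - (if i = k then q $ k else 0)" for i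
    by (simp add: q'_def axis_def)
  have "q' \<in> std_simplex"
    unfolding std_simplex_def
  proof (intro CollectI conjI allI)
    fix i
    show "0 \<le> q' $ i" using q'_nth[of i] qs(1)[of i] qs(1)[of k] by (auto split: if_splits)
  next
    have "(\<Sum>i\<in>UNIV. q' $ i - q $ i) = 0" by (simp add: q'_nth sum_subtractf)
    then show "(\<Sum>i\<in>UNIV. q' $ i) = 1" using qs(3) by (simp add: sum_subtractf)
  qed
  then have "0 \<le> (\<Sum>i\<in>UNIV. (x $ i / (2 - q $ i) + a $ i) * (q' $ i - q $ i))"
    by (rule best_response_variational[OF best])
  also have "\<dots> = (x $ j / (2 - q $ j) + a $ j) * q $ k - (x $ k / (2 - q $ k) + a $ k) * q $ k"
    by (simp add: q'_nth right_diff_distrib sum_subtractf if_distrib[of "(*) _"] cong: if_cong)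
  finally have "x $ k / (2 - q $ k) + a $ k \<le> x $ j / (2 - q $ j) + a $ j"
    using k by simp
  moreover have "x $ j / (2 - q $ j) < x $ j"
    using j xs(2)[of j] by (simp add: field_simps)
  moreover have "x $ k / 2 < x $ k / (2 - q $ k)"
    using k qs(2)[of k] xs(2)[of k] by (intro divide_strict_left_mono) auto
  ultimately show False using dom by simp
qed

text \<open>A coordinate \<open>j \<in> S\<close> that dominates all coordinates outside \<open>S\<close> for both weights confines both
  best responses to \<open>S\<close>, where the payoffs coincide. Hence a best response for \<open>a\<close> is one for \<open>b\<close>.\<close>

lemma fo_oracle_hard_fun_cong:
  fixes a b x :: "real^'n"
  assumes "L > 0" and x: "x \<in> rel_interior std_simplex"
    and agree: "\<And>k. k \<in> S \<Longrightarrow> a $ k = b $ k" and j: "j \<in> S"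
    and dom_a: "\<And>k. k \<notin> S \<Longrightarrow> a $ j + x $ j \<le> a $ k + x $ k / 2"
    and dom_b: "\<And>k. k \<notin> S \<Longrightarrow> b $ j + x $ j \<le> b $ k + x $ k / 2"
  shows "fo_oracle (hard_fun L a) x = fo_oracle (hard_fun L b) x"
proof -
  obtain p q where p: "best_response a x p" and q: "best_response b x q"
    using best_response_exists by metis
  have eq: "payoff a x r = payoff b x r" if "\<And>k. k \<notin> S \<Longrightarrow> r $ k = 0" for r
    unfolding payoff_def using agree that by (intro sum.cong) force+
  have p0: "p $ k = 0" if "k \<notin> S" for k
    using best_response_dominated_eq_0[OF x p _ dom_a[OF that]] that j by metis
  have q0: "q $ k = 0" if "k \<notin> S" for k
    using best_response_dominated_eq_0[OF x q _ dom_b[OF that]] that j by metis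
  have "payoff b x q \<le> payoff b x p"
    using eq[OF p0] eq[OF q0] p q unfolding best_response_def by metis
  then have "best_response b x p"
    using p q unfolding best_response_def by (meson order_trans)
  then show ?thesis
    using fo_oracle_hard_fun[OF \<open>L > 0\<close> x] p eq[OF p0] by simp
qed

section \<open>The resisting oracle\<close>

text \<open>The \<open>i\<close>-th coordinate of a distinct list has weight \<open>i / (16 N\<^sup>2)\<close>; \<open>LEAST\<close> recovers the position
  of \<open>k\<close> in the list.\<close>

definition weights :: "nat \<Rightarrow> 'n list \<Rightarrow> real^'n" where
  "weights N is = (\<chi> k. if k \<in> set is
     then real (LEAST i. i < length is \<and> is ! i = k) / (16 * real N ^ 2) else 1 / (2 * real N))"

lemma weights_nth:
  assumes "distinct is" "i < length is"
  shows "weights N is $ (is ! i) = real i / (16 * real N ^ 2)"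
proof -
  have "(LEAST i'. i' < length is \<and> is ! i' = is ! i) = i"
    using assms by (intro Least_equality) (auto simp: nth_eq_iff_index_eq)
  then show ?thesis using assms by (simp add: weights_def)
qed

lemma weights_not_in: "k \<notin> set is \<Longrightarrow> weights N is $ k = 1 / (2 * real N)"
  by (simp add: weights_def)

text \<open>Weights increase along the list, and the default weight is above all of them, since
  \<open>N / (16 N\<^sup>2) \<le> 1 / (2 N)\<close>.\<close>

lemma weights_ge:
  assumes "distinct is" "length is \<le> N" "0 < N" "i \<le> N" "k \<notin> set (take i is)"
  shows "real i / (16 * real N ^ 2) \<le> weights N is $ k"
proof (cases "k \<in> set is")
  case True
  then obtain i' where i': "i' < length is" "is ! i' = k" by (auto simp: in_set_conv_nth)
  have "i \<le> i'"
  proof (rule ccontr)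
    assume "\<not> i \<le> i'"
    then have "k \<in> set (take i is)" using i' by (auto simp: in_set_conv_nth)
    then show False using assms by simp
  qed
  then show ?thesis using weights_nth[OF assms(1) i'(1), of N] i' by (simp add: divide_right_mono)
next
  case False
  have "real i / (16 * real N ^ 2) \<le> real N / (16 * real N ^ 2)"
    using assms by (intro divide_right_mono) auto
  also have "\<dots> \<le> 1 / (2 * real N)" using assms by (simp add: field_simps power2_eq_square)
  finally show ?thesis using False by (simp add: weights_not_in)
qed

text \<open>The state of the adversary. All queries are those of the method run on the function of the whole
  list \<open>is\<close>, although the coordinate \<open>is ! i\<close> is picked when only \<open>take i is\<close> is known; lemma
  \<open>answers_snoc_unchanged\<close> below shows that extending the list leaves these queries alone.\<close>

definition resists :: "real \<Rightarrow> nat \<Rightarrow> 'n::finite fom \<Rightarrow> 'n list \<Rightarrow> bool" where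
  "resists L N M is \<longleftrightarrow> distinct is \<and>
     (\<forall>i<length is. let x = query_point M (hard_fun L (weights N is)) (Suc i) in
        x \<in> rel_interior std_simplex \<and> x $ (is ! i) \<le> 1 / (8 * real N ^ 2) \<and>
        (\<forall>k. k \<notin> set (take i is) \<longrightarrow> x $ (is ! i) \<le> x $ k))"

text \<open>At the query of index \<open>t\<close>, the coordinate \<open>is ! t\<close> dominates every coordinate \<open>k\<close> outside
  \<open>take (Suc t) is\<close>: since \<open>x $ (is ! t) \<le> x $ k\<close>, domination needs an advantage in weight of
  \<open>x $ (is ! t) / 2\<close>, and this is at most the weight step \<open>1 / (16 N\<^sup>2)\<close>. So the oracle sees no
  difference between the weights for \<open>is\<close> and for \<open>is @ [j]\<close>.\<close>

lemma answers_snoc_unchanged: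
  fixes M :: "'n::finite fom"
  assumes "L > 0" and res: "resists L N M is" and len: "length is < N" and j: "j \<notin> set is"
    and "t \<le> length is"
  shows "answers M (hard_fun L (weights N (is @ [j]))) t = answers M (hard_fun L (weights N is)) t"
  using \<open>t \<le> length is\<close>
proof (induction t)
  case (Suc t)
  let ?a = "weights N is" and ?b = "weights N (is @ [j])"
  define x where "x = query_point M (hard_fun L ?a) (Suc t)"
  have t: "t < length is" using Suc.prems by simp
  have dist: "distinct is" using res by (simp add: resists_def)
  have distb: "distinct (is @ [j])" using dist j by simp
  have x: "x \<in> rel_interior std_simplex" "x $ (is ! t) \<le> 1 / (8 * real N ^ 2)"
    "\<And>k. k \<notin> set (take t is) \<Longrightarrow> x $ (is ! t) \<le> x $ k"
    using res t unfolding resists_def Let_def x_def by blast+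
  let ?S = "set (take (Suc t) is)"
  have a: "?a $ (is ! t) = real t / (16 * real N ^ 2)" by (rule weights_nth[OF dist t])
  have b: "?b $ (is ! i) = ?a $ (is ! i)" if "i < length is" for i
    using weights_nth[OF dist that, of N] weights_nth[OF distb, of i N] that by (simp add: nth_append)
  have gap: "real t / (16 * real N ^ 2) + x $ (is ! t) \<le> c + x $ k / 2"
    if "real (Suc t) / (16 * real N ^ 2) \<le> c" "k \<notin> ?S" for c k
  proof -
    have "k \<notin> set (take t is)" using that(2) t by (auto simp: take_Suc_conv_app_nth)
    then have "x $ (is ! t) \<le> x $ k" by (rule x(3))
    then show ?thesis using x(2) that(1) by (simp add: add_divide_distrib)
  qed
  have "fo_oracle (hard_fun L ?b) x = fo_oracle (hard_fun L ?a) x"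
  proof (rule fo_oracle_hard_fun_cong[OF \<open>L > 0\<close> x(1)])
    show "is ! t \<in> ?S" using t by (simp add: take_Suc_conv_app_nth)
  next
    fix k assume "k \<in> ?S"
    then obtain i where "i < length is" "k = is ! i" by (auto simp: in_set_conv_nth)
    then show "?b $ k = ?a $ k" using b by simp
  next
    fix k assume k: "k \<notin> ?S"
    have "real (Suc t) / (16 * real N ^ 2) \<le> ?b $ k"
      using distb len t k by (intro weights_ge) auto
    then show "?b $ (is ! t) + x $ (is ! t) \<le> ?b $ k + x $ k / 2"
      using gap[OF _ k] b[OF t] a by simp
  next
    fix k assume k: "k \<notin> ?S"
    have "real (Suc t) / (16 * real N ^ 2) \<le> ?a $ k"
      using dist len t k by (intro weights_ge) auto
    then show "?a $ (is ! t) + x $ (is ! t) \<le> ?a $ k + x $ k / 2"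
      using gap[OF _ k] a by simp
  qed
  then show ?case using Suc by (simp add: x_def query_point_def)
qed simp

text \<open>At least \<open>8 N\<^sup>2\<close> fresh coordinates share a total mass of at most \<open>1\<close>.\<close>

lemma smallest_fresh_coordinate:
  fixes x :: "real^'n" and "is" :: "'n list"
  assumes x: "x \<in> std_simplex" and "0 < N" and dim: "8 * N ^ 2 + length is \<le> CARD('n)"
  obtains j where "j \<notin> set is" "\<And>k. k \<notin> set is \<Longrightarrow> x $ j \<le> x $ k" "x $ j \<le> 1 / (8 * real N ^ 2)"
proof -
  have "CARD('n) - length is \<le> CARD('n) - card (set is)"
    using card_length by (intro diff_le_mono2)
  also have "\<dots> = card (- set is)" by (simp add: Compl_eq_Diff_UNIV card_Diff_subset)
  finally have card: "8 * N ^ 2 \<le> card (- set is)" using dim by simp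
  then have ne: "- set is \<noteq> {}" using \<open>0 < N\<close> by (intro notI) simp
  define j where "j = arg_min_on (($) x) (- set is)"
  have j: "j \<notin> set is" using arg_min_if_finite(1)[OF _ ne, of "($) x"] by (simp add: j_def)
  have min: "x $ j \<le> x $ k" if "k \<notin> set is" for k
    using arg_min_least[OF _ ne, of k "($) x"] that by (simp add: j_def)
  have "real (8 * N ^ 2) * x $ j \<le> real (card (- set is)) * x $ j"
    using card std_simplexD(1)[OF x] by (intro mult_right_mono) (simp_all only: of_nat_le_iff)
  also have "\<dots> = (\<Sum>k\<in>- set is. x $ j)" by simp
  also have "\<dots> \<le> (\<Sum>k\<in>- set is. x $ k)" using min by (intro sum_mono) auto
  also have "\<dots> \<le> (\<Sum>k\<in>UNIV. x $ k)" using std_simplexD(1)[OF x] by (intro sum_mono2) auto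
  finally have "real (8 * N ^ 2) * x $ j \<le> 1" using std_simplexD(3)[OF x] by simp
  then have "x $ j \<le> 1 / (8 * real N ^ 2)" using \<open>0 < N\<close> by (simp add: field_simps)
  with that j min show thesis by blast
qed

lemma answers_in_answer_tuples:
  fixes M :: "'n::finite fom"
  assumes M: "M \<in> FOM T" and f: "f \<in> Ent L" and "t \<le> T"
  shows "answers M f t \<in> answer_tuples t"
  using \<open>t \<le> T\<close>
proof (induction t)
  case (Suc t)
  let ?x = "fst M (Suc t) (answers M f t)"
  have "?x \<in> rel_interior std_simplex"
    using M Suc by (fastforce simp: FOM_def split: prod.splits)
  then obtain g where g: "has_tangent_gradient f g ?x" and x: "?x \<in> rel_interior std_simplex"
    using f by (auto simp: Ent_def)
  have "tangent_gradient f ?x \<in> tangent_space"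
    using g tangent_gradient_eqI[OF x g] by (simp add: has_tangent_gradient_def)
  then show ?case using Suc by (simp add: answer_tuples_def fo_oracle_def)
qed (simp add: answer_tuples_def)

lemma query_point_in_rel_interior:
  fixes M :: "'n::finite fom"
  assumes "M \<in> FOM T" "f \<in> Ent L" "t < T"
  shows "query_point M f (Suc t) \<in> rel_interior std_simplex"
  using assms answers_in_answer_tuples[OF assms(1,2), of t]
  by (fastforce simp: FOM_def query_point_def split: prod.splits)

lemma output_point_in_std_simplex:
  fixes M :: "'n::finite fom"
  assumes "M \<in> FOM T" "f \<in> Ent L"
  shows "output_point T M f \<in> std_simplex"
  using assms answers_in_answer_tuples[OF assms, of T]
  by (auto simp: FOM_def output_point_def split: prod.splits)

lemma resisting_sequence_exists:
  fixes M :: "'n::finite fom"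
  assumes "L > 0" and M: "M \<in> FOM T" and dim: "8 * (T + 1) ^ 2 + T \<le> CARD('n)" and "s \<le> T"
  shows "\<exists>is. length is = s \<and> resists L (T + 1) M is"
  using \<open>s \<le> T\<close>
proof (induction s)
  case 0
  show ?case by (intro exI[of _ "[]"]) (simp add: resists_def)
next
  case (Suc s)
  then obtain "is" where len: "length is = s" and res: "resists L (T + 1) M is" by auto
  let ?f = "\<lambda>is. hard_fun L (weights (T + 1) is)"
  let ?x = "query_point M (?f is) (Suc s)"
  have x: "?x \<in> rel_interior std_simplex"
    using query_point_in_rel_interior[OF M hard_fun_in_Ent[OF \<open>L > 0\<close>]] Suc.prems by simp
  obtain j where j: "j \<notin> set is" "\<And>k. k \<notin> set is \<Longrightarrow> ?x $ j \<le> ?x $ k"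
      "?x $ j \<le> 1 / (8 * real (T + 1) ^ 2)"
    using smallest_fresh_coordinate[OF rel_interior_std_simplexD(1)[OF x], of "T + 1" "is"]
      dim len Suc.prems by auto
  have same: "query_point M (?f (is @ [j])) (Suc i) = query_point M (?f is) (Suc i)"
    if "i \<le> s" for i
    using answers_snoc_unchanged[OF \<open>L > 0\<close> res _ j(1), of i] that len Suc.prems
    by (simp add: query_point_def)
  have "resists L (T + 1) M (is @ [j])"
    unfolding resists_def Let_def
  proof (intro conjI allI impI)
    show "distinct (is @ [j])" using res j(1) by (simp add: resists_def)
  next
    fix i assume "i < length (is @ [j])"
    then consider "i < s" | "i = s" using len by fastforce
    then have i: "query_point M (?f is) (Suc i) \<in> rel_interior std_simplex \<and>
      query_point M (?f is) (Suc i) $ ((is @ [j]) ! i) \<le> 1 / (8 * real (T + 1) ^ 2) \<and>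
      (\<forall>k. k \<notin> set (take i (is @ [j])) \<longrightarrow>
         query_point M (?f is) (Suc i) $ ((is @ [j]) ! i) \<le> query_point M (?f is) (Suc i) $ k)"
    proof cases
      case 1
      then show ?thesis using res len by (simp add: resists_def Let_def nth_append)
    next
      case 2
      then have "(is @ [j]) ! i = j" using len by (simp add: nth_append)
      then show ?thesis using 2 x j len by simp
    qed
    have eq: "query_point M (?f (is @ [j])) (Suc i) = query_point M (?f is) (Suc i)"
      using \<open>i < length (is @ [j])\<close> len by (intro same) simp
    show "query_point M (?f (is @ [j])) (Suc i) \<in> rel_interior std_simplex"
      "query_point M (?f (is @ [j])) (Suc i) $ ((is @ [j]) ! i) \<le> 1 / (8 * real (T + 1) ^ 2)"
      using i unfolding eq by blast+
    fix k assume "k \<notin> set (take i (is @ [j]))"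
    then show "query_point M (?f (is @ [j])) (Suc i) $ ((is @ [j]) ! i)
        \<le> query_point M (?f (is @ [j])) (Suc i) $ k"
      using i unfolding eq by blast
  qed
  then show ?case using len by (intro exI[of _ "is @ [j]"]) simp
qed

section \<open>The optimality gap\<close>

text \<open>The bound comes from the budget \<open>axis j 1\<close> and \<open>ln 2 < 1\<close>.\<close>

lemma hard_fun_ge_single_bet:
  fixes x a :: "real^'n"
  assumes "L > 0" and "x \<in> std_simplex"
  shows "- L * (x $ j + a $ j) \<le> hard_fun L a x"
proof -
  obtain q where q: "best_response a x q" using best_response_exists by blast
  have "payoff a x (axis j 1) =
      (\<Sum>k\<in>UNIV. if k = j then x $ j * ln (1 / 2) - a $ j else 0)"
    unfolding payoff_def by (intro sum.cong) (auto simp: axis_def)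
  then have "payoff a x (axis j 1) = - (x $ j * ln 2) - a $ j"
    by (simp add: ln_div)
  moreover have "x $ j * ln 2 \<le> x $ j"
    using std_simplexD(1)[OF assms(2), of j] ln_2_less_1 by (simp add: mult_left_le)
  ultimately have "- (x $ j + a $ j) \<le> payoff a x q"
    using q axis_in_std_simplex[of j] unfolding best_response_def by fastforce
  then show ?thesis
    using \<open>L > 0\<close> by (simp add: hard_fun_eq_payoff[OF q] flip: mult_minus_right)
qed

text \<open>Under the uniform distribution on \<open>is\<close>, each unit of budget costs at least \<open>1 / (2 N)\<close>: on a
  listed coordinate through \<open>- ln (1 - q / 2) \<ge> q / 2\<close> and the mass \<open>1 / N\<close>, on any other coordinate
  through its weight.\<close>

lemma hard_fun_low_value:
  fixes "is" :: "'n::finite list"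
  assumes "L > 0" and "distinct is" and len: "length is = N" and "N > 0"
  obtains y where "y \<in> std_simplex" "hard_fun L (weights N is) y \<le> - L / (2 * real N)"
proof
  let ?a = "weights N is"
  let ?y = "(\<chi> k. if k \<in> set is then 1 / real N else 0) :: real^'n"
  have card: "card (set is) = N" using assms by (simp add: distinct_card)
  show "?y \<in> std_simplex"
    using \<open>N > 0\<close> by (simp add: std_simplex_def sum.If_cases card)
  obtain q where q: "best_response ?a ?y q" using best_response_exists by blast
  then have qs: "q \<in> std_simplex" by (simp add: best_response_def)
  have "payoff ?a ?y q \<le> (\<Sum>k\<in>UNIV. - (1 / (2 * real N)) * q $ k)"
    unfolding payoff_def
  proof (rule sum_mono)
    fix k
    have "0 \<le> q $ k" "q $ k \<le> 1" using std_simplexD[OF qs] by auto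
    show "?y $ k * ln (1 - q $ k / 2) - ?a $ k * q $ k \<le> - (1 / (2 * real N)) * q $ k"
    proof (cases "k \<in> set is")
      case True
      have "0 \<le> ?a $ k" by (simp add: weights_def)
      then have "0 \<le> ?a $ k * q $ k" using \<open>0 \<le> q $ k\<close> by simp
      moreover have "ln (1 - q $ k / 2) \<le> - (q $ k / 2)"
        using \<open>q $ k \<le> 1\<close> ln_le_minus_one[of "1 - q $ k / 2"] by simp
      then have "1 / real N * ln (1 - q $ k / 2) \<le> 1 / real N * - (q $ k / 2)"
        by (intro mult_left_mono) auto
      ultimately show ?thesis using True by simp
    next
      case False
      then show ?thesis by (simp add: weights_not_in)
    qed
  qed
  also have "\<dots> = - (1 / (2 * real N))"
    unfolding sum_distrib_left[symmetric] std_simplexD(3)[OF qs] by simp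
  finally have "L * payoff ?a ?y q \<le> L * - (1 / (2 * real N))"
    using \<open>L > 0\<close> by (intro mult_left_mono) auto
  then show "hard_fun L ?a ?y \<le> - L / (2 * real N)"
    by (simp add: hard_fun_eq_payoff[OF q])
qed

text \<open>The adversary lets the method run for \<open>T\<close> queries, then reveals one more coordinate \<open>j\<close>, which is
  small in the output. The answers, hence the output, are those of the run before \<open>j\<close> was revealed.
  The total cost of \<open>j\<close> there is at most
  \<open>1 / (8 N\<^sup>2) + (N - 1) / (16 N\<^sup>2) = (N + 1) / (16 N\<^sup>2) \<le> 3 / (16 N)\<close>.\<close>

lemma hard_instance_exists:
  fixes M :: "'n::finite fom"
  assumes "L > 0" and M: "M \<in> FOM T" and dim: "8 * (T + 1) ^ 2 + T \<le> CARD('n)"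
  shows "\<exists>f\<in>Ent L. ereal (5 * L / (16 * real (T + 1))) \<le> optimality_gap f (output_point T M f)"
proof -
  let ?N = "T + 1"
  let ?f = "\<lambda>is. hard_fun L (weights ?N is)"
  obtain "is" where len: "length is = T" and res: "resists L ?N M is"
    using resisting_sequence_exists[OF assms order_refl] by blast
  let ?x = "output_point T M (?f is)"
  have x: "?x \<in> std_simplex"
    by (rule output_point_in_std_simplex[OF M hard_fun_in_Ent[OF \<open>L > 0\<close>]])
  obtain j where j: "j \<notin> set is" "?x $ j \<le> 1 / (8 * real ?N ^ 2)"
    using smallest_fresh_coordinate[OF x, of ?N "is"] dim len by auto
  let ?is = "is @ [j]"
  have dist: "distinct ?is" using res j(1) by (simp add: resists_def)
  have out: "output_point T M (?f ?is) = ?x"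
    using answers_snoc_unchanged[OF \<open>L > 0\<close> res _ j(1), of T] len by (simp add: output_point_def)
  obtain y where y: "y \<in> std_simplex" "?f ?is y \<le> - L / (2 * real ?N)"
    using hard_fun_low_value[OF \<open>L > 0\<close> dist, of ?N] len by auto
  have N: "real ?N > 0" by simp
  have "weights ?N ?is $ j = real T / (16 * real ?N ^ 2)"
    using weights_nth[OF dist, of T ?N] len by (simp add: nth_append)
  also have "\<dots> \<le> (real ?N - 1) / (16 * real ?N ^ 2)" by simp
  finally have "?x $ j + weights ?N ?is $ j \<le> 1 / (8 * real ?N ^ 2) + (real ?N - 1) / (16 * real ?N ^ 2)"
    using j(2) by linarith
  also have "\<dots> \<le> 3 / (16 * real ?N)"
  proof -
    have "1 / (8 * n ^ 2) + (n - 1) / (16 * n ^ 2) \<le> 3 / (16 * n)" if "1 \<le> n" for n :: real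
    proof -
      have "1 / (8 * n ^ 2) + (n - 1) / (16 * n ^ 2) = (n + 1) / (16 * n ^ 2)"
        using that by (simp add: field_simps)
      also have "\<dots> \<le> (3 * n) / (16 * n ^ 2)" using that by (intro divide_right_mono) auto
      also have "\<dots> = 3 / (16 * n)" using that by (simp add: power2_eq_square)
      finally show ?thesis .
    qed
    from this[of "real ?N"] show ?thesis by simp
  qed
  finally have "L * (?x $ j + weights ?N ?is $ j) \<le> L * (3 / (16 * real ?N))"
    using \<open>L > 0\<close> by (intro mult_left_mono) auto
  then have fx: "- (3 * L / (16 * real ?N)) \<le> ?f ?is ?x"
    using hard_fun_ge_single_bet[OF \<open>L > 0\<close> x, of j "weights ?N ?is"] by simp
  have "(INF y\<in>std_simplex. ereal (?f ?is y)) \<le> ereal (- L / (2 * real ?N))"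
    using y by (intro INF_lower2[of y]) auto
  then have gap: "ereal (?f ?is ?x) - ereal (- L / (2 * real ?N)) \<le> optimality_gap (?f ?is) ?x"
    unfolding optimality_gap_def by (rule ereal_minus_mono[OF order_refl])
  have "5 * L / (16 * n) = - (3 * L / (16 * n)) - - L / (2 * n)" for n :: real
    by (cases "n = 0") (simp_all add: field_simps)
  then have "5 * L / (16 * real ?N) \<le> ?f ?is ?x - - L / (2 * real ?N)"
    by (rule ord_eq_le_trans) (rule diff_right_mono[OF fx])
  then have "ereal (5 * L / (16 * real ?N)) \<le> ereal (?f ?is ?x) - ereal (- L / (2 * real ?N))"
    by (simp only: ereal_minus(1) ereal_less_eq(3))
  from order_trans[OF this gap]
  have "ereal (5 * L / (16 * real ?N)) \<le> optimality_gap (?f ?is) ?x" .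
  then show ?thesis
    using hard_fun_in_Ent[OF \<open>L > 0\<close>] out by (intro bexI[of _ "?f ?is"]) auto
qed

theorem theorem5:
  fixes L :: real and T :: nat
  assumes "L > 0" and "T \<ge> 1" and "CARD('n::finite) \<ge> 8 * (T + 1)^2 + T"
  shows "minimax_risk TYPE('n) T L > ereal (L / (4 * (real T + 1)))"
proof -
  have "ereal (L / (4 * (real T + 1))) < ereal (5 * L / (16 * real (T + 1)))"
  proof -
    have "L / (4 * n) < 5 * L / (16 * n)" if "n > 0" for n :: real
      using assms(1) that by (simp add: field_simps)
    from this[of "real T + 1"] show ?thesis by (simp add: add.commute)
  qed
  also have "\<dots> \<le> minimax_risk TYPE('n) T L"
    unfolding minimax_risk_def
  proof (rule INF_greatest)
    fix M :: "'n fom" assume "M \<in> FOM T"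
    then obtain f where f: "f \<in> Ent L"
        "ereal (5 * L / (16 * real (T + 1))) \<le> optimality_gap f (output_point T M f)"
      using hard_instance_exists assms by blast
    show "ereal (5 * L / (16 * real (T + 1)))
        \<le> (SUP f\<in>Ent L. optimality_gap f (output_point T M f))"
      by (rule SUP_upper2[OF f(1)]) (rule f(2))
  qed
  finally show ?thesis .
qed

end
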